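(* Let $L\ge 1$ and $0\le n\le L-1$ be integers and let $0\le q\le p\le 1$ with $p>0$. In the system with $L$ sites and $n$ ordinary particles, the steady state currents of the tracer particle $\hat 1$ and of the ordinary particles $1$ are $$J_{\hat 1}=(p-q)\,\frac{\begin{Bmatrix}L-1\\ n+1\end{Bmatrix}_{p,q}}{Z_{L,n}(p,q)},\qquad J_1=(p-q)\,\frac{n\begin{Bmatrix}L-1\\ n+1\end{Bmatrix}_{p,q}}{Z_{L,n}(p,q)}.$$
   Context: Configurations: $\Omega_{L,n}$ is the set of words $\eta=(\eta_1,\dots,\eta_L)$ with letters in $\{0,1,\hat 1\}$ containing exactly one $\hat 1$ (tracer particle), exactly $n$ letters $1$ (ordinary particles) and $L-n-1$ letters $0$ (vacancies). Sites are indexed mod $L$. Dynamics: a continuous-time Markov chain on $\Omega_{L,n}$ in which, for each bond $(i,i+1)$ (mod $L$): $10\to 01$ at rate $1$, $01\to 10$ at rate $1$, $\hat 1 0\to 0\hat 1$ at rate $p$, $0\hat 1\to\hat 1 0$ at rate $q$; no other transitions occur. Steady state: for $L\ge n+2$, $\pi$ is the unique stationary distribution; for $L=n+1$ (no moves), $\pi$ is by convention uniform on $\Omega_{L,n}$. $\langle\cdot\rangle_{L,n}$ is expectation under $\pi$. $\sigma_i=1$ if $\eta_i=\hat 1$ and $0$ otherwise; $\tau_i=1$ if $\eta_i=1$ and $0$ otherwise. Currents: the current across a bond is the mean number of jumps per unit time across it in the forward direction (from $i$ to $i+1$) minus that in the reverse direction, in the steady state; it does not depend on the bond. Explicitly,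 for the bond from site $L$ to site $1$, $$J_{\hat 1}=p\langle\sigma_L(1-\tau_1-\sigma_1)\rangle_{L,n}-q\langle(1-\tau_L-\sigma_L)\sigma_1\rangle_{L,n},$$ $$J_1=\langle\tau_L(1-\tau_1-\sigma_1)\rangle_{L,n}-\langle(1-\tau_L-\sigma_L)\tau_1\rangle_{L,n}.$$ Partition functions: for $\eta\in\Omega_{L,n}$ with $\eta_1=\hat 1$, $$w(\eta)=\prod_{\substack{2\le i\le L\\ \eta_i=0}}\bigl(1+p\,m_i(\eta)+q\,n_i(\eta)\bigr),$$ where $m_i(\eta)$ (resp. $n_i(\eta)$) is the number of $1$'s among $\eta_2,\dots,\eta_{i-1}$ (resp. $\eta_{i+1},\dots,\eta_L$). Put $$\begin{Bmatrix}L\\ n+1\end{Bmatrix}_{p,q}=\sum_{\eta\in\Omega_{L,n},\ \eta_1=\hat 1}w(\eta)\quad(0\le n\le L-1),\qquad Z_{L,n}(p,q)=L\begin{Bmatrix}L\\ n+1\end{Bmatrix}_{p,q},$$ and $\begin{Bmatrix}a\\ b\end{Bmatrix}_{p,q}=0$ when $a<b$. *)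

theory Defs
  imports "HOL-Probability.Probability_Mass_Function"
begin

datatype letter = Vac | Ord | Tracer

text \<open>
  Words are lists, so the site \<open>i\<close> of \<open>{1, \<dots>, L}\<close> is the list index \<open>i - 1\<close>.  The number of
  letters \<open>Vac\<close> is \<open>L - n - 1\<close> because of the length.
\<close>

definition configs :: "nat \<Rightarrow> nat \<Rightarrow> letter list set" where
  "configs L n = {\<eta>. length \<eta> = L \<and> count_list \<eta> Tracer = 1 \<and> count_list \<eta> Ord = n}"

fun bond_rate :: "real \<Rightarrow> real \<Rightarrow> letter \<Rightarrow> letter \<Rightarrow> real" where
  "bond_rate p q Ord Vac = 1"
| "bond_rate p q Vac Ord = 1"
| "bond_rate p q Tracer Vac = p"
| "bond_rate p q Vac Tracer = q"
| "bond_rate p q _ _ = 0"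

definition next_site :: "letter list \<Rightarrow> nat \<Rightarrow> nat" where
  "next_site \<eta> i = Suc i mod length \<eta>"

definition swap_bond :: "letter list \<Rightarrow> nat \<Rightarrow> letter list" where
  "swap_bond \<eta> i = \<eta>[i := \<eta> ! next_site \<eta> i, next_site \<eta> i := \<eta> ! i]"

text \<open>
  The sum over bonds matters for \<open>L = 2\<close>, where two different bonds lead to the same
  configuration and their rates add up.
\<close>

definition jump_rate :: "real \<Rightarrow> real \<Rightarrow> letter list \<Rightarrow> letter list \<Rightarrow> real" where
  "jump_rate p q \<eta> \<eta>' =
     (\<Sum>i<length \<eta>. if \<eta>' = swap_bond \<eta> i then bond_rate p q (\<eta> ! i) (\<eta> ! next_site \<eta> i) else 0)"

definition stationary :: "nat \<Rightarrow> nat \<Rightarrow> real \<Rightarrow> real \<Rightarrow> letter list pmf \<Rightarrow> bool" where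
  "stationary L n p q \<pi> \<longleftrightarrow>
     set_pmf \<pi> \<subseteq> configs L n \<and>
     (\<forall>\<eta>\<in>configs L n.
        (\<Sum>\<eta>'\<in>configs L n. pmf \<pi> \<eta>' * jump_rate p q \<eta>' \<eta>) =
        pmf \<pi> \<eta> * (\<Sum>\<eta>'\<in>configs L n. jump_rate p q \<eta> \<eta>'))"

definition steady_state :: "nat \<Rightarrow> nat \<Rightarrow> real \<Rightarrow> real \<Rightarrow> letter list pmf" where
  "steady_state L n p q =
     (if n + 2 \<le> L then (THE \<pi>. stationary L n p q \<pi>) else pmf_of_set (configs L n))"

definition steady_mean :: "nat \<Rightarrow> nat \<Rightarrow> real \<Rightarrow> real \<Rightarrow> (letter list \<Rightarrow> real) \<Rightarrow> real" where
  "steady_mean L n p q f = measure_pmf.expectation (steady_state L n p q) f"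

definition sigma :: "nat \<Rightarrow> letter list \<Rightarrow> real" where
  "sigma i \<eta> = of_bool (\<eta> ! (i - 1) = Tracer)"

definition tau :: "nat \<Rightarrow> letter list \<Rightarrow> real" where
  "tau i \<eta> = of_bool (\<eta> ! (i - 1) = Ord)"

text \<open>
  The arguments of \<open>sigma\<close> and \<open>tau\<close> are sites, numbered from \<open>1\<close>.  The currents are those
  across the bond from site \<open>L\<close> to site \<open>1\<close>.
\<close>

definition tracer_current :: "nat \<Rightarrow> nat \<Rightarrow> real \<Rightarrow> real \<Rightarrow> real" where
  "tracer_current L n p q =
     p * steady_mean L n p q (\<lambda>\<eta>. sigma L \<eta> * (1 - tau 1 \<eta> - sigma 1 \<eta>))
     - q * steady_mean L n p q (\<lambda>\<eta>. (1 - tau L \<eta> - sigma L \<eta>) * sigma 1 \<eta>)"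

definition ordinary_current :: "nat \<Rightarrow> nat \<Rightarrow> real \<Rightarrow> real \<Rightarrow> real" where
  "ordinary_current L n p q =
     steady_mean L n p q (\<lambda>\<eta>. tau L \<eta> * (1 - tau 1 \<eta> - sigma 1 \<eta>))
     - steady_mean L n p q (\<lambda>\<eta>. (1 - tau L \<eta> - sigma L \<eta>) * tau 1 \<eta>)"

text \<open>In \<open>weight\<close>, the index \<open>0\<close> (the first site, which holds the tracer) is left out.\<close>

definition weight :: "real \<Rightarrow> real \<Rightarrow> letter list \<Rightarrow> real" where
  "weight p q \<eta> =
     (\<Prod>i\<in>{i. 1 \<le> i \<and> i < length \<eta> \<and> \<eta> ! i = Vac}.
        1 + p * real (card {j. 1 \<le> j \<and> j < i \<and> \<eta> ! j = Ord})
          + q * real (card {j. i < j \<and> j < length \<eta> \<and> \<eta> ! j = Ord}))"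

text \<open>\<open>bracket p q a b\<close> is the two-row brace symbol with entries \<open>a\<close> over \<open>b\<close>, for \<open>b \<ge> 1\<close>.\<close>

definition bracket :: "real \<Rightarrow> real \<Rightarrow> nat \<Rightarrow> nat \<Rightarrow> real" where
  "bracket p q a b =
     (if 1 \<le> b \<and> b \<le> a
      then \<Sum>\<eta>\<in>{\<eta> \<in> configs a (b - 1). \<eta> ! 0 = Tracer}. weight p q \<eta>
      else 0)"

definition Z :: "nat \<Rightarrow> nat \<Rightarrow> real \<Rightarrow> real \<Rightarrow> real" where
  "Z L n p q = real L * bracket p q L (n + 1)"

end

theory Submission
  imports Defs
begin

text \<open>
  Rotating a configuration so that the tracer comes first leaves a word without tracer, and the
  stationary weight is the weight of that word.  Exchanging neighbouring letters \<open>Ord\<close> and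
  \<open>Vac\<close> changes the weight by \<open>\<plusminus>(p - q)\<close> times the weight of the word with that
  \<open>Vac\<close> deleted, so the net probability flow into a configuration telescopes over each block of
  vacancies, and what is left at the two ends is cancelled by the two bonds of the tracer.
  Since the weights are positive, a Dirichlet form argument shows that the ratio of any stationary
  distribution to them does not change along a possible jump in either direction; moving
  vacancies around connects all configurations, whence uniqueness.  The currents follow by deleting
  the vacancy that takes part in a jump: the terms in which the
  tracer jumps differ by \<open>p (1 + q n) - q (1 + p n) = p - q\<close>, and for the ordinary particles
  every one of the \<open>n\<close> letters \<open>Ord\<close> of the shorter word contributes \<open>p - q\<close>.
\<close>

section \<open>Words read off from the tracer, and their weights\<close>

definition words :: "nat \<Rightarrow> nat \<Rightarrow> letter list set" where
  "words M n = {x. length x = M \<and> Tracer \<notin> set x \<and> count_list x Ord = n}"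

text \<open>
  Here \<open>n\<close> is the total number of letters \<open>Ord\<close> on the ring and \<open>a\<close> the number of
  those already passed to the left.  A letter \<open>Tracer\<close> never occurs in the argument.
\<close>

fun wt :: "real \<Rightarrow> real \<Rightarrow> nat \<Rightarrow> nat \<Rightarrow> letter list \<Rightarrow> real" where
  "wt p q n a [] = 1"
| "wt p q n a (Vac # x) = (1 + p * real a + q * (real n - real a)) * wt p q n a x"
| "wt p q n a (Ord # x) = wt p q n (Suc a) x"
| "wt p q n a (Tracer # x) = wt p q n a x"

definition unwrap :: "letter list \<Rightarrow> letter list" where
  "unwrap \<eta> = tl (dropWhile (\<lambda>s. s \<noteq> Tracer) \<eta>) @ takeWhile (\<lambda>s. s \<noteq> Tracer) \<eta>"

definition conf_wt :: "real \<Rightarrow> real \<Rightarrow> nat \<Rightarrow> letter list \<Rightarrow> real" where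
  "conf_wt p q n \<eta> = wt p q n 0 (unwrap \<eta>)"

lemma wt_append: "wt p q n a (x @ y) = wt p q n a x * wt p q n (a + count_list x Ord) y"
  by (induction p q n a x rule: wt.induct) auto

text \<open>The bound keeps the number of letters \<open>Ord\<close> still to come nonnegative at
  each vacancy, so every factor is at least 1.\<close>

lemma wt_pos:
  assumes "0 \<le> p" "0 \<le> q" "a + count_list x Ord \<le> n"
  shows "0 < wt p q n a x"
  using assms
proof (induction p q n a x rule: wt.induct)
  case (2 p q n a x)
  then have "0 \<le> p * real a" "0 \<le> q * (real n - real a)" by auto
  with 2 show ?case by (simp add: add_pos_nonneg)
qed auto

text \<open>Links the recursive form, suited to induction on the word, with the product over sites
  in \<open>weight\<close>.\<close>

lemma wt_eq_prod:
  "wt p q n a x = (\<Prod>i<length x. if x ! i = Vac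
     then 1 + p * real (a + count_list (take i x) Ord)
       + q * (real n - real (a + count_list (take i x) Ord)) else 1)"
proof (induction p q n a x rule: wt.induct)
  case (1 p q n a)
  then show ?case by simp
next
  case (2 p q n a x)
  then show ?case by (simp add: prod.lessThan_Suc_shift del: prod.lessThan_Suc cong: if_cong)
next
  case (3 p q n a x)
  then show ?case
    by (simp add: prod.lessThan_Suc_shift add_ac del: prod.lessThan_Suc cong: if_cong)
next
  case (4 p q n a x)
  then show ?case by (simp add: prod.lessThan_Suc_shift del: prod.lessThan_Suc cong: if_cong)
qed

lemma card_count_list: "card {j. j < length x \<and> x ! j = c} = count_list x c"
  by (simp add: count_list_eq_length_filter length_filter_conv_card eq_commute)

lemma weight_Tracer_Cons:
  assumes "x \<in> words M n"
  shows "weight p q (Tracer # x) = wt p q n 0 x"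
proof -
  let ?\<eta> = "Tracer # x"
  have len: "length x = M" and cnt: "count_list x Ord = n"
    using assms by (auto simp: words_def)
  have l: "card {j. 1 \<le> j \<and> j < Suc i \<and> ?\<eta> ! j = Ord} = count_list (take i x) Ord"
    if "i < M" for i
  proof -
    have "{j. 1 \<le> j \<and> j < Suc i \<and> ?\<eta> ! j = Ord} = Suc ` {j. j < i \<and> x ! j = Ord}"
      by (auto simp: image_iff gr0_conv_Suc Suc_le_eq)
    moreover have "{j. j < i \<and> x ! j = Ord} = {j. j < length (take i x) \<and> take i x ! j = Ord}"
      using that len by auto
    ultimately show ?thesis
      by (simp only: card_image[OF inj_Suc] card_count_list)
  qed
  have r: "card {j. Suc i < j \<and> j < length ?\<eta> \<and> ?\<eta> ! j = Ord} = count_list (drop (Suc i) x) Ord"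
    if "i < M" for i
  proof -
    \<comment> \<open>The offset consists of the \<open>Suc i\<close> dropped letters of
      \<open>x\<close> and the leading tracer.\<close>
    have "{j. Suc i < j \<and> j < length ?\<eta> \<and> ?\<eta> ! j = Ord}
        = (\<lambda>j. j + Suc (Suc i)) ` {j. j < length (drop (Suc i) x) \<and> drop (Suc i) x ! j = Ord}"
    proof (intro equalityI subsetI)
      fix j assume j: "j \<in> {j. Suc i < j \<and> j < length ?\<eta> \<and> ?\<eta> ! j = Ord}"
      then obtain k where "j = Suc (Suc i) + k" using less_iff_Suc_add by auto
      with j show "j \<in> (\<lambda>j. j + Suc (Suc i)) ` {j. j < length (drop (Suc i) x) \<and> drop (Suc i) x ! j = Ord}"
        by (intro image_eqI[of _ _ k]) (auto simp: add_ac)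
    qed (auto simp: add_ac)
    then show ?thesis
      by (simp only: card_image[OF inj_on_add'] card_count_list)
  qed
  \<comment> \<open>The letter at \<open>i\<close> is a vacancy, so the \<open>n\<close> letters
    \<open>Ord\<close> lie strictly before or strictly after it; the inequality makes the
    subtraction exact.\<close>
  have split: "count_list (drop (Suc i) x) Ord = n - count_list (take i x) Ord
      \<and> count_list (take i x) Ord \<le> n" if "i < M" "x ! i = Vac" for i
  proof -
    have "x = take i x @ x ! i # drop (Suc i) x" using that len by (intro id_take_nth_drop) simp
    then have "count_list x Ord = count_list (take i x @ x ! i # drop (Suc i) x) Ord" by simp
    then show ?thesis using cnt that by simp
  qed
  let ?f = "\<lambda>i. 1 + p * real (card {j. 1 \<le> j \<and> j < i \<and> ?\<eta> ! j = Ord})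
          + q * real (card {j. i < j \<and> j < length ?\<eta> \<and> ?\<eta> ! j = Ord})"
  have "{i. 1 \<le> i \<and> i < length ?\<eta> \<and> ?\<eta> ! i = Vac} = Suc ` {i. i < M \<and> x ! i = Vac}"
    using len by (auto simp: image_iff gr0_conv_Suc Suc_le_eq)
  then have "weight p q ?\<eta> = (\<Prod>i\<in>Suc ` {i. i < M \<and> x ! i = Vac}. ?f i)"
    by (simp only: weight_def)
  also have "\<dots> = (\<Prod>i\<in>{i. i < M \<and> x ! i = Vac}. ?f (Suc i))"
    by (subst prod.reindex) (auto simp only: inj_Suc o_def)
  also have "\<dots> = (\<Prod>i\<in>{i. i < M \<and> x ! i = Vac}. 1 + p * real (0 + count_list (take i x) Ord)
       + q * (real n - real (0 + count_list (take i x) Ord)))"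
    by (intro prod.cong refl) (use l r split in \<open>simp only: mem_Collect_eq, simp add: of_nat_diff\<close>)
  also have "\<dots> = wt p q n 0 x"
    unfolding wt_eq_prod len
    by (rule prod.mono_neutral_cong_left) auto
  finally show ?thesis .
qed

lemma configs_0_Tracer:
  "{\<eta> \<in> configs (Suc M) n. \<eta> ! 0 = Tracer} = Cons Tracer ` words M n"
proof (intro equalityI subsetI)
  fix \<eta> assume "\<eta> \<in> {\<eta> \<in> configs (Suc M) n. \<eta> ! 0 = Tracer}"
  then show "\<eta> \<in> Cons Tracer ` words M n"
    by (cases \<eta>) (auto simp: configs_def words_def count_list_0_iff)
qed (auto simp: configs_def words_def)

lemma bracket_eq_sum_words:
  assumes "n \<le> M"
  shows "bracket p q (Suc M) (n + 1) = (\<Sum>x\<in>words M n. wt p q n 0 x)"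
proof -
  have "bracket p q (Suc M) (n + 1) = (\<Sum>\<eta>\<in>Cons Tracer ` words M n. weight p q \<eta>)"
    using assms unfolding bracket_def configs_0_Tracer[symmetric] by simp
  then show ?thesis
    by (simp add: sum.reindex inj_on_def weight_Tracer_Cons cong: sum.cong)
qed

section \<open>Unwrapping a configuration, and invariance under rotation\<close>

lemma unwrap_append: "Tracer \<notin> set v \<Longrightarrow> unwrap (v @ Tracer # u) = u @ v"
  by (induction v) (auto simp: unwrap_def takeWhile_append dropWhile_append)

lemma unwrap_Cons: "unwrap (Tracer # u) = u"
  using unwrap_append[of "[]"] by simp

lemma tracer_split:
  assumes "count_list \<eta> Tracer = 1"
  obtains v u where "\<eta> = v @ Tracer # u" "Tracer \<notin> set v" "Tracer \<notin> set u"
proof -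
  have "Tracer \<in> set \<eta>" using assms by (metis count_notin zero_neq_one)
  then obtain v u where "\<eta> = v @ Tracer # u" "Tracer \<notin> set v" by (metis split_list_first)
  moreover from this assms have "Tracer \<notin> set u" by (auto simp: count_list_0_iff)
  ultimately show ?thesis using that by blast
qed

lemma unwrap_rotate1:
  assumes "count_list \<eta> Tracer = 1"
  shows "unwrap (rotate1 \<eta>) = unwrap \<eta>"
proof -
  obtain v u where e: "\<eta> = v @ Tracer # u" "Tracer \<notin> set v" "Tracer \<notin> set u"
    using tracer_split[OF assms] .
  show ?thesis
  proof (cases v)
    case Nil
    then show ?thesis using e unwrap_append[of u "[]"] by (simp add: unwrap_Cons)
  next
    case (Cons b v')
    then show ?thesis using e unwrap_append[of v' "u @ [b]"] unwrap_append[of v u] by simp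
  qed
qed

lemma conf_wt_rotate1:
  "count_list \<eta> Tracer = 1 \<Longrightarrow> conf_wt p q n (rotate1 \<eta>) = conf_wt p q n \<eta>"
  by (simp add: conf_wt_def unwrap_rotate1)

section \<open>Exchanges across a bond\<close>

lemma next_site_less: "i < length \<eta> \<Longrightarrow> next_site \<eta> i < length \<eta>"
  by (auto simp: next_site_def intro!: mod_less_divisor)

lemma length_swap_bond [simp]: "length (swap_bond \<eta> i) = length \<eta>"
  by (simp add: swap_bond_def)

lemma next_site_swap_bond [simp]: "next_site (swap_bond \<eta> i) j = next_site \<eta> j"
  by (simp add: next_site_def)

lemma mset_swap_bond: "i < length \<eta> \<Longrightarrow> mset (swap_bond \<eta> i) = mset \<eta>"
  unfolding swap_bond_def by (rule mset_swap) (auto intro: next_site_less)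

lemma count_list_swap_bond: "i < length \<eta> \<Longrightarrow> count_list (swap_bond \<eta> i) c = count_list \<eta> c"
  by (metis count_mset mset_swap_bond)

lemma swap_bond_in_configs: "\<eta> \<in> configs L n \<Longrightarrow> i < L \<Longrightarrow> swap_bond \<eta> i \<in> configs L n"
  by (auto simp: configs_def count_list_swap_bond)

lemma nth_swap_bond:
  assumes "i < length \<eta>"
  shows "swap_bond \<eta> i ! i = \<eta> ! next_site \<eta> i" "swap_bond \<eta> i ! next_site \<eta> i = \<eta> ! i"
  using assms next_site_less[OF assms] by (auto simp: swap_bond_def nth_list_update)

lemma swap_bond_swap_bond:
  assumes "i < length \<eta>"
  shows "swap_bond (swap_bond \<eta> i) i = \<eta>"
proof -
  define k where "k = next_site \<eta> i"
  have k: "k < length \<eta>" using next_site_less[OF assms] by (simp add: k_def)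
  have "swap_bond (swap_bond \<eta> i) i = (swap_bond \<eta> i)[i := \<eta> ! i, k := \<eta> ! k]"
    using nth_swap_bond[OF assms] by (simp add: swap_bond_def[of "swap_bond \<eta> i"] k_def)
  then show ?thesis
    using assms k by (auto intro!: nth_equalityI simp: swap_bond_def nth_list_update k_def[symmetric])
qed

text \<open>\<open>rotate1\<close> brings the letter at \<open>Suc i\<close> to \<open>i\<close>, so
  the bonds are renumbered cyclically.\<close>

lemma swap_bond_rotate1:
  assumes "i < length \<eta>"
  shows "swap_bond (rotate1 \<eta>) i = rotate1 (swap_bond \<eta> (Suc i mod length \<eta>))"
proof (rule nth_equalityI)
  fix j assume "j < length (swap_bond (rotate1 \<eta>) i)"
  then have j: "j < length \<eta>" by simp
  have s: "Suc k mod length \<eta> < length \<eta>" for k using j by (auto intro: mod_less_divisor)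
  \<comment> \<open>Injectivity of the cyclic successor decides which of the two updated sites, if
    any, is being read.\<close>
  have inj: "Suc k mod length \<eta> = Suc l mod length \<eta> \<longleftrightarrow> k = l"
    if "k < length \<eta>" "l < length \<eta>" for k l
    using that by (auto simp: mod_Suc split: if_splits)
  show "swap_bond (rotate1 \<eta>) i ! j = rotate1 (swap_bond \<eta> (Suc i mod length \<eta>)) ! j"
    using assms j s[of i] s[of j] s[of "Suc i mod length \<eta>"]
    by (simp add: swap_bond_def next_site_def nth_rotate1 nth_list_update inj)
qed simp

section \<open>The net flow into a configuration vanishes\<close>

text \<open>
  The net probability flow into \<open>\<eta>\<close> through the bond \<open>i\<close>: the only configuration from
  which \<open>\<eta>\<close> can be reached through that bond is \<open>swap_bond \<eta> i\<close>.
\<close>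

definition flux :: "real \<Rightarrow> real \<Rightarrow> nat \<Rightarrow> letter list \<Rightarrow> nat \<Rightarrow> real" where
  "flux p q n \<eta> i =
     conf_wt p q n (swap_bond \<eta> i) * bond_rate p q (\<eta> ! next_site \<eta> i) (\<eta> ! i)
     - conf_wt p q n \<eta> * bond_rate p q (\<eta> ! i) (\<eta> ! next_site \<eta> i)"

lemma flux_rotate1:
  assumes "count_list \<eta> Tracer = 1" "i < length \<eta>"
  shows "flux p q n (rotate1 \<eta>) i = flux p q n \<eta> (Suc i mod length \<eta>)"
proof -
  have s: "Suc k mod length \<eta> < length \<eta>" for k using assms by (auto intro: mod_less_divisor)
  show ?thesis
    using assms s
    by (simp add: flux_def swap_bond_rotate1 conf_wt_rotate1 count_list_swap_bond
        next_site_def nth_rotate1)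
qed

lemma sum_flux_rotate1:
  assumes "count_list \<eta> Tracer = 1"
  shows "(\<Sum>i<length \<eta>. flux p q n (rotate1 \<eta>) i) = (\<Sum>i<length \<eta>. flux p q n \<eta> i)"
proof -
  obtain m where m: "length \<eta> = Suc m" using assms by (cases \<eta>) auto
  have "(\<Sum>i<length \<eta>. flux p q n (rotate1 \<eta>) i) = (\<Sum>i<Suc m. flux p q n \<eta> (Suc i mod Suc m))"
    using flux_rotate1[OF assms] m by (intro sum.cong) auto
  also have "\<dots> = (\<Sum>i<m. flux p q n \<eta> (Suc i)) + flux p q n \<eta> 0"
    by (simp only: sum.lessThan_Suc mod_self, intro arg_cong2[of _ _ _ _ "(+)"] sum.cong refl)
      auto
  finally show ?thesis by (simp only: m sum.lessThan_Suc_shift add.commute)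
qed

text \<open>The flux through a bond away from the tracer: \<open>Ord\<close> and \<open>Vac\<close>
  exchange at the same rate in both directions, so gain minus loss is a difference of weights times
  one rate.\<close>

definition adj :: "real \<Rightarrow> real \<Rightarrow> nat \<Rightarrow> nat \<Rightarrow> letter list \<Rightarrow> nat \<Rightarrow> real" where
  "adj p q n a x j =
     (wt p q n a (x[j := x ! Suc j, Suc j := x ! j]) - wt p q n a x)
     * bond_rate p q (x ! j) (x ! Suc j)"

text \<open>Deleting any vacancy of a block gives the same word, so the contributions of the two
  ends of a block are opposite and cancel. Only a block touching an end of the word keeps an
  unpaired term. In the induction a leading \<open>Vac\<close> multiplies the later terms by its
  factor, and a leading \<open>Ord\<close> raises \<open>a\<close>.\<close>

lemma sum_adj:
  assumes "x \<noteq> []" "Tracer \<notin> set x"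
  shows "(\<Sum>j<length x - 1. adj p q n a x j) =
    (p - q) * (of_bool (hd x = Vac) * wt p q n a (tl x)
      - of_bool (last x = Vac) * wt p q n a (butlast x))"
  using assms
proof (induction x arbitrary: a rule: induct_list012)
  case (3 b c x)
  have IH: "(\<Sum>j<length x. adj p q n a (c # x) j) =
    (p - q) * (of_bool (c = Vac) * wt p q n a x
      - of_bool (last (c # x) = Vac) * wt p q n a (butlast (c # x)))" for a
    using 3 by simp
  have eq: "(\<Sum>j<length (b # c # x) - 1. adj p q n a (b # c # x) j)
    = adj p q n a (b # c # x) 0 + (\<Sum>j<length x. adj p q n a (b # c # x) (Suc j))"
    by (simp add: sum.lessThan_Suc_shift del: sum.lessThan_Suc)
  show ?case
  proof (cases b)
    case Vac
    have "adj p q n a (b # c # x) (Suc j)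
        = (1 + p * real a + q * (real n - real a)) * adj p q n a (c # x) j" for j
      by (simp add: adj_def Vac algebra_simps)
    then have "(\<Sum>j<length x. adj p q n a (b # c # x) (Suc j))
       = (1 + p * real a + q * (real n - real a)) * (\<Sum>j<length x. adj p q n a (c # x) j)"
      by (simp add: sum_distrib_left)
    then show ?thesis
      using 3 unfolding eq IH by (cases c) (auto simp: Vac adj_def algebra_simps)
  next
    case Ord
    have "adj p q n a (b # c # x) (Suc j) = adj p q n (Suc a) (c # x) j" for j
      by (simp add: adj_def Ord)
    then have "(\<Sum>j<length x. adj p q n a (b # c # x) (Suc j))
       = (\<Sum>j<length x. adj p q n (Suc a) (c # x) j)"
      by simp
    then show ?thesis
      using 3 unfolding eq IH by (cases c) (auto simp: Ord adj_def algebra_simps)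
  qed (use 3 in simp)
qed auto

lemma conf_wt_Cons: "conf_wt p q n (Tracer # x) = wt p q n 0 x"
  by (simp add: conf_wt_def unwrap_Cons)

text \<open>A vacancy next to the tracer has factor \<open>1 + q * n\<close> as first letter of the
  word and \<open>1 + p * n\<close> as last letter. Gain minus loss is
  \<open>q * (1 + p * n) - p * (1 + q * n)\<close>, that is, \<open>-(p - q)\<close>.\<close>

lemma flux_Tracer_first:
  assumes "x \<in> words M n" "x \<noteq> []"
  shows "flux p q n (Tracer # x) 0 = - (p - q) * of_bool (hd x = Vac) * wt p q n 0 (tl x)"
proof -
  obtain b y where x: "x = b # y" using assms by (cases x) auto
  show ?thesis
  proof (cases b)
    case Vac
    have "swap_bond (Tracer # x) 0 = [Vac] @ Tracer # y"
      by (simp add: swap_bond_def next_site_def x Vac)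
    then have "conf_wt p q n (swap_bond (Tracer # x) 0) = wt p q n 0 (y @ [Vac])"
      using unwrap_append[of "[Vac]" y] by (simp add: conf_wt_def)
    moreover have "count_list y Ord = n" using assms by (simp add: words_def x Vac)
    ultimately show ?thesis
      by (simp add: flux_def next_site_def x Vac conf_wt_Cons wt_append algebra_simps)
  qed (use assms in \<open>auto simp: flux_def next_site_def x words_def\<close>)
qed

text \<open>The mirror image, at the bond \<open>M\<close> that joins the last site to the tracer at
  index 0: the factors and rates trade places and the sign changes.\<close>

lemma flux_Tracer_last:
  assumes "x \<in> words M n" "x \<noteq> []"
  shows "flux p q n (Tracer # x) M = (p - q) * of_bool (last x = Vac) * wt p q n 0 (butlast x)"
proof -
  obtain b y where x: "x = y @ [b]" using assms by (cases x rule: rev_cases) auto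
  have M: "M = Suc (length y)" using assms by (simp add: words_def x)
  have Tr: "Tracer \<notin> set (b # y)" using assms by (auto simp: words_def x)
  show ?thesis
  proof (cases b)
    case Vac
    have "swap_bond (Tracer # x) M = (b # y) @ Tracer # []"
      by (simp add: swap_bond_def next_site_def x M)
    then have "conf_wt p q n (swap_bond (Tracer # x) M) = wt p q n 0 (b # y)"
      using unwrap_append[OF Tr, of "[]"] by (simp add: conf_wt_def)
    moreover have "count_list y Ord = n" using assms by (simp add: words_def x Vac)
    ultimately show ?thesis
      by (simp add: flux_def next_site_def x M Vac conf_wt_Cons wt_append algebra_simps)
  qed (use assms in \<open>auto simp: flux_def next_site_def x M words_def\<close>)
qed

lemma flux_middle:
  assumes "x \<in> words M n" "Suc j < M"
  shows "flux p q n (Tracer # x) (Suc j) = adj p q n 0 x j"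
proof -
  have len: "length x = M" using assms by (simp add: words_def)
  have "x ! j \<noteq> Tracer" "x ! Suc j \<noteq> Tracer"
    using assms nth_mem[of j x] nth_mem[of "Suc j" x] by (force simp: words_def)+
  then have "bond_rate p q (x ! j) (x ! Suc j) = bond_rate p q (x ! Suc j) (x ! j)"
    by (cases "x ! j"; cases "x ! Suc j") auto
  then show ?thesis
    using assms(2) len
    by (simp add: flux_def adj_def next_site_def swap_bond_def conf_wt_Cons algebra_simps)
qed

lemma sum_flux_Tracer_Cons:
  assumes "x \<in> words M n" "x \<noteq> []"
  shows "(\<Sum>i<Suc M. flux p q n (Tracer # x) i) = 0"
proof -
  have len: "length x = M" "Tracer \<notin> set x" using assms by (auto simp: words_def)
  then obtain m where M: "M = Suc m" using assms by (cases M) auto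
  have "(\<Sum>i<Suc M. flux p q n (Tracer # x) i)
     = flux p q n (Tracer # x) 0 + (\<Sum>j<m. flux p q n (Tracer # x) (Suc j))
       + flux p q n (Tracer # x) M"
    by (simp only: M sum.lessThan_Suc_shift[of _ "Suc m"] sum.lessThan_Suc[of _ m] add.assoc)
  also have "(\<Sum>j<m. flux p q n (Tracer # x) (Suc j)) = (\<Sum>j<length x - 1. adj p q n 0 x j)"
    using flux_middle[OF assms(1)] len by (intro sum.cong) (auto simp: M)
  finally show ?thesis
    unfolding flux_Tracer_first[OF assms] flux_Tracer_last[OF assms] sum_adj[OF assms(2) len(2)]
    by (simp add: algebra_simps)
qed

lemma count_list_rotate: "count_list (rotate k x) c = count_list x c"
proof -
  have "count_list (rotate1 x) c = count_list x c" for x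
    by (cases x) auto
  then show ?thesis by (induction k) auto
qed

text \<open>Rotation only permutes the bonds, so the tracer may be taken to come first;
  \<open>2 \<le> L\<close> makes the remaining word nonempty.\<close>

lemma sum_flux_eq_0:
  assumes "\<eta> \<in> configs L n" "2 \<le> L"
  shows "(\<Sum>i<L. flux p q n \<eta> i) = 0"
proof -
  have len: "length \<eta> = L" and cT: "count_list \<eta> Tracer = 1" and cO: "count_list \<eta> Ord = n"
    using assms by (auto simp: configs_def)
  obtain v u where e: "\<eta> = v @ Tracer # u" "Tracer \<notin> set v" "Tracer \<notin> set u"
    using tracer_split[OF cT] .
  have w: "u @ v \<in> words (L - 1) n" using e len cO by (auto simp: words_def)
  have rot: "(\<Sum>i<L. flux p q n (rotate k \<eta>) i) = (\<Sum>i<L. flux p q n \<eta> i)" for k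
  proof (induction k)
    case (Suc k)
    have "count_list (rotate k \<eta>) Tracer = 1" by (simp add: count_list_rotate cT)
    from sum_flux_rotate1[OF this] show ?case using Suc len by simp
  qed simp
  have "rotate (length v) \<eta> = Tracer # u @ v"
    by (simp add: e rotate_append)
  moreover have "u @ v \<noteq> []" using w assms by (auto simp: words_def)
  ultimately show ?thesis
    using sum_flux_Tracer_Cons[OF w, of p q] rot[of "length v"] assms by (simp del: append_is_Nil_conv)
qed

section \<open>Sums over configurations and the partition function\<close>

lemma finite_configs: "finite (configs L n)"
proof -
  have "finite {\<eta>. set \<eta> \<subseteq> {Vac, Ord, Tracer} \<and> length \<eta> = L}"
    by (rule finite_lists_length_eq) simp
  moreover have "set \<eta> \<subseteq> {Vac, Ord, Tracer}" for \<eta>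
    using letter.exhaust by blast
  ultimately show ?thesis
    by (auto elim!: finite_subset[rotated] simp: configs_def)
qed

lemma finite_words: "finite (words M n)"
proof -
  have "words M n \<subseteq> {x. set x \<subseteq> {Vac, Ord} \<and> length x = M}"
    unfolding words_def using letter.exhaust by blast
  then show ?thesis
    by (rule finite_subset) (simp add: finite_lists_length_eq)
qed

text \<open>A configuration is a word together with a position of the tracer: \<open>k\<close>
  letters of the word follow the tracer, which therefore has index \<open>M - k\<close>.\<close>

lemma sum_configs:
  "(\<Sum>\<eta>\<in>configs (Suc M) n. f \<eta>) =
    (\<Sum>k\<le>M. \<Sum>x\<in>words M n. f (drop k x @ Tracer # take k x))"
proof -
  have dT: "Tracer \<notin> set (drop k x)" if "x \<in> words M n" for k x
    using that by (auto simp: words_def dest: in_set_dropD)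
  have "(\<Sum>\<eta>\<in>configs (Suc M) n. f \<eta>) =
    (\<Sum>(k, x)\<in>{..M} \<times> words M n. f (drop k x @ Tracer # take k x))"
  proof (rule sum.reindex_bij_witness[where
      i = "\<lambda>(k, x). drop k x @ Tracer # take k x" and
      j = "\<lambda>\<eta>. (M - length (takeWhile (\<lambda>s. s \<noteq> Tracer) \<eta>), unwrap \<eta>)"])
    fix \<eta> assume \<eta>: "\<eta> \<in> configs (Suc M) n"
    then obtain v u where e: "\<eta> = v @ Tracer # u" "Tracer \<notin> set v" "Tracer \<notin> set u"
      using tracer_split[of \<eta>] by (auto simp: configs_def)
    have tw: "takeWhile (\<lambda>s. s \<noteq> Tracer) \<eta> = v" using e by (simp add: takeWhile_append)
    have len: "M = length u + length v" using \<eta> e by (simp add: configs_def)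
    show "(case (M - length (takeWhile (\<lambda>s. s \<noteq> Tracer) \<eta>), unwrap \<eta>) of
        (k, x) \<Rightarrow> drop k x @ Tracer # take k x) = \<eta>"
      unfolding tw using e by (simp add: unwrap_append len)
    then show "(case (M - length (takeWhile (\<lambda>s. s \<noteq> Tracer) \<eta>), unwrap \<eta>) of
        (k, x) \<Rightarrow> f (drop k x @ Tracer # take k x)) = f \<eta>"
      by simp
    show "(M - length (takeWhile (\<lambda>s. s \<noteq> Tracer) \<eta>), unwrap \<eta>) \<in> {..M} \<times> words M n"
      using e \<eta> by (simp add: unwrap_append words_def configs_def)
  next
    fix b assume b: "b \<in> {..M} \<times> words M n"
    then obtain k x where kx: "b = (k, x)" "k \<le> M" "x \<in> words M n" by auto
    have len: "length x = M" using kx by (simp add: words_def)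
    have "count_list (take k x @ drop k x) c = count_list x c" for c by simp
    then have cnt: "count_list (take k x) c + count_list (drop k x) c = count_list x c" for c
      by (simp del: append_take_drop_id)
    have "takeWhile (\<lambda>s. s \<noteq> Tracer) (drop k x @ Tracer # take k x) = drop k x"
      using dT[OF kx(3)] by (subst takeWhile_append2) auto
    then show "(M - length (takeWhile (\<lambda>s. s \<noteq> Tracer) (case b of (k, x) \<Rightarrow> drop k x @ Tracer # take k x)),
        unwrap (case b of (k, x) \<Rightarrow> drop k x @ Tracer # take k x)) = b"
      using kx len dT[OF kx(3)] by (simp add: unwrap_append)
    show "(case b of (k, x) \<Rightarrow> drop k x @ Tracer # take k x) \<in> configs (Suc M) n"
      using kx len cnt[of Ord] cnt[of Tracer]
      by (auto simp: configs_def words_def add.commute)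
  qed
  then show ?thesis by (simp add: sum.cartesian_product)
qed

lemma conf_wt_unrotate:
  "x \<in> words M n \<Longrightarrow> conf_wt p q n (drop k x @ Tracer # take k x) = wt p q n 0 x"
  unfolding conf_wt_def by (subst unwrap_append) (auto simp: words_def dest: in_set_dropD)

text \<open>The weight ignores the position of the tracer, and the \<open>L\<close> positions give
  the factor \<open>L\<close> in \<open>Z\<close>.\<close>

lemma sum_conf_wt:
  assumes "n + 1 \<le> L"
  shows "(\<Sum>\<eta>\<in>configs L n. conf_wt p q n \<eta>) = Z L n p q"
proof -
  obtain M where L: "L = Suc M" using assms by (cases L) auto
  show ?thesis
    using assms bracket_eq_sum_words[of n M p q] unfolding L sum_configs Z_def
    by (simp add: conf_wt_unrotate)
qed

lemma conf_wt_pos: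
  assumes "0 \<le> p" "0 \<le> q" "\<eta> \<in> configs L n"
  shows "0 < conf_wt p q n \<eta>"
proof -
  obtain v u where "\<eta> = v @ Tracer # u" "Tracer \<notin> set v" "Tracer \<notin> set u"
    using assms tracer_split[of \<eta>] by (auto simp: configs_def)
  then show ?thesis
    using assms by (auto simp: conf_wt_def unwrap_append configs_def intro!: wt_pos)
qed

lemma Z_pos:
  assumes "0 \<le> p" "0 \<le> q" "n + 1 \<le> L"
  shows "0 < Z L n p q"
proof -
  have "Tracer # replicate n Ord @ replicate (L - 1 - n) Vac \<in> configs L n"
    using assms by (auto simp: configs_def count_list_0_iff
        simp flip: count_mset)
  then have "0 < (\<Sum>\<eta>\<in>configs L n. conf_wt p q n \<eta>)"
    using assms by (intro sum_pos finite_configs conf_wt_pos) auto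
  then show ?thesis using assms by (simp add: sum_conf_wt)
qed

section \<open>Jump rates and the balance equation\<close>

lemma swap_bond_eq_iff:
  assumes "length \<eta> = length \<eta>'" "i < length \<eta>"
  shows "\<eta> = swap_bond \<eta>' i \<longleftrightarrow> \<eta>' = swap_bond \<eta> i"
  using assms swap_bond_swap_bond by metis

text \<open>An exchange is its own inverse, so each bond has exactly one predecessor of \<eta>.
  Summing by bonds also counts correctly when several bonds give the same configuration.\<close>

lemma sum_jump_rate_in:
  assumes "\<eta> \<in> configs L n"
  shows "(\<Sum>\<eta>'\<in>configs L n. g \<eta>' * jump_rate p q \<eta>' \<eta>) =
    (\<Sum>i<L. g (swap_bond \<eta> i) * bond_rate p q (\<eta> ! next_site \<eta> i) (\<eta> ! i))"
proof -
  have len: "length \<eta> = L" using assms by (simp add: configs_def)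
  have "(\<Sum>\<eta>'\<in>configs L n. g \<eta>' * jump_rate p q \<eta>' \<eta>)
    = (\<Sum>\<eta>'\<in>configs L n. \<Sum>i<L. if \<eta>' = swap_bond \<eta> i
        then g \<eta>' * bond_rate p q (\<eta>' ! i) (\<eta>' ! next_site \<eta>' i) else 0)"
    by (intro sum.cong refl)
      (auto simp: jump_rate_def sum_distrib_left configs_def len swap_bond_eq_iff intro!: sum.cong)
  also have "\<dots> = (\<Sum>i<L. g (swap_bond \<eta> i) *
      bond_rate p q (swap_bond \<eta> i ! i) (swap_bond \<eta> i ! next_site \<eta> i))"
    using assms by (subst sum.swap) (simp add: sum.delta finite_configs swap_bond_in_configs)
  also have "\<dots> = (\<Sum>i<L. g (swap_bond \<eta> i) * bond_rate p q (\<eta> ! next_site \<eta> i) (\<eta> ! i))"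
    using len by (intro sum.cong) (auto simp: nth_swap_bond)
  finally show ?thesis .
qed

lemma sum_jump_rate_out:
  assumes "\<eta> \<in> configs L n"
  shows "(\<Sum>\<eta>'\<in>configs L n. jump_rate p q \<eta> \<eta>') =
    (\<Sum>i<L. bond_rate p q (\<eta> ! i) (\<eta> ! next_site \<eta> i))"
proof -
  have len: "length \<eta> = L" using assms by (simp add: configs_def)
  show ?thesis
    unfolding jump_rate_def len
    by (subst sum.swap) (simp add: sum.delta finite_configs swap_bond_in_configs[OF assms])
qed

lemma conf_wt_balance:
  assumes "\<eta> \<in> configs L n" "2 \<le> L"
  shows "(\<Sum>\<eta>'\<in>configs L n. conf_wt p q n \<eta>' * jump_rate p q \<eta>' \<eta>) =
    conf_wt p q n \<eta> * (\<Sum>\<eta>'\<in>configs L n. jump_rate p q \<eta> \<eta>')"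
  using sum_flux_eq_0[OF assms, of p q]
  unfolding sum_jump_rate_in[OF assms(1)] sum_jump_rate_out[OF assms(1)] flux_def
  by (simp add: sum_subtractf sum_distrib_left)

section \<open>Ratios of solutions of the balance equation\<close>

lemma balance_ratio_eq:
  fixes r :: "'a \<Rightarrow> 'a \<Rightarrow> real" and u w :: "'a \<Rightarrow> real"
  assumes fin: "finite C"
    and w: "\<And>x. x \<in> C \<Longrightarrow> 0 < w x"
    and r: "\<And>x y. x \<in> C \<Longrightarrow> y \<in> C \<Longrightarrow> 0 \<le> r x y"
    and bw: "\<And>x. x \<in> C \<Longrightarrow> (\<Sum>y\<in>C. w y * r y x) = w x * (\<Sum>y\<in>C. r x y)"
    and bu: "\<And>x. x \<in> C \<Longrightarrow> (\<Sum>y\<in>C. u y * r y x) = u x * (\<Sum>y\<in>C. r x y)"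
    and xy: "x \<in> C" "y \<in> C" "0 < r x y"
  shows "u x / w x = u y / w y"
proof -
  define h where "h = (\<lambda>x. u x / w x)"
  define out where "out = (\<lambda>x. \<Sum>y\<in>C. r x y)"
  have uh: "u x = w x * h x" if "x \<in> C" for x
    using w[OF that] by (simp add: h_def)
  \<comment> \<open>Balance for \<open>u\<close> and for \<open>w\<close> makes the Dirichlet form of \<open>h\<close> vanish.\<close>
  have "(\<Sum>x\<in>C. \<Sum>y\<in>C. w x * r x y * (h x - h y)\<^sup>2)
    = (\<Sum>x\<in>C. \<Sum>y\<in>C. w x * (h x)\<^sup>2 * r x y)
      - 2 * (\<Sum>x\<in>C. \<Sum>y\<in>C. h y * (u x * r x y))
      + (\<Sum>x\<in>C. \<Sum>y\<in>C. (h y)\<^sup>2 * (w x * r x y))"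
    unfolding sum_distrib_left sum_subtractf[symmetric] sum.distrib[symmetric]
    by (intro sum.cong refl) (simp add: uh power2_eq_square algebra_simps)
  \<comment> \<open>All three double sums have the same value \<open>S\<close>: the first directly,
    the second by balance of \<open>u\<close>, the third by balance of \<open>w\<close>. The total
    is \<open>S - 2 * S + S\<close>.\<close>
  also have "(\<Sum>x\<in>C. \<Sum>y\<in>C. w x * (h x)\<^sup>2 * r x y) = (\<Sum>x\<in>C. w x * (h x)\<^sup>2 * out x)"
    by (simp add: out_def sum_distrib_left)
  also have "(\<Sum>x\<in>C. \<Sum>y\<in>C. h y * (u x * r x y)) = (\<Sum>x\<in>C. w x * (h x)\<^sup>2 * out x)"
    by (subst sum.swap, intro sum.cong refl)
      (simp only: sum_distrib_left[symmetric] bu out_def[symmetric],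
       simp add: uh power2_eq_square out_def)
  also have "(\<Sum>x\<in>C. \<Sum>y\<in>C. (h y)\<^sup>2 * (w x * r x y)) = (\<Sum>x\<in>C. w x * (h x)\<^sup>2 * out x)"
    by (subst sum.swap, intro sum.cong refl)
      (simp only: sum_distrib_left[symmetric] bw, simp add: out_def)
  finally have z: "(\<Sum>x\<in>C. \<Sum>y\<in>C. w x * r x y * (h x - h y)\<^sup>2) = 0" by simp
  have nn: "0 \<le> w x * r x y * (h x - h y)\<^sup>2" if "x \<in> C" "y \<in> C" for x y
    using that w[of x] r[of x y] by simp
  have "(\<Sum>y\<in>C. w x * r x y * (h x - h y)\<^sup>2) = 0"
    using z xy nn fin by (subst (asm) sum_nonneg_eq_0_iff) (auto intro!: sum_nonneg)
  then have "w x * r x y * (h x - h y)\<^sup>2 = 0"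
    using xy nn fin by (subst (asm) sum_nonneg_eq_0_iff) auto
  then show ?thesis using w[OF xy(1)] xy(3) by (simp add: h_def)
qed

section \<open>Connectivity, expressed by functions invariant under exchanges with a vacancy\<close>

context
  fixes L n :: nat and f :: "letter list \<Rightarrow> 'a"
  assumes L: "n + 2 \<le> L"
    and swap_inv: "\<And>\<eta> i. \<eta> \<in> configs L n \<Longrightarrow> i < L \<Longrightarrow>
      \<eta> ! i = Vac \<or> \<eta> ! next_site \<eta> i = Vac \<Longrightarrow> f (swap_bond \<eta> i) = f \<eta>"
begin

lemma swap_Vac:
  assumes "u @ c # Vac # v \<in> configs L n"
  shows "f (u @ Vac # c # v) = f (u @ c # Vac # v)"
proof -
  let ?\<eta> = "u @ c # Vac # v"
  have len: "length ?\<eta> = L" using assms by (simp add: configs_def)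
  then have nx: "next_site ?\<eta> (length u) = Suc (length u)" by (simp add: next_site_def)
  have "?\<eta> ! Suc (length u) = Vac" by (simp add: nth_append)
  moreover have "swap_bond ?\<eta> (length u) = u @ Vac # c # v"
    unfolding swap_bond_def nx by (simp add: nth_append list_update_append)
  ultimately show ?thesis
    using swap_inv[OF assms, of "length u"] len nx by simp
qed

lemma swap_Vac_replicate:
  assumes "u @ c # replicate k Vac @ v \<in> configs L n"
  shows "f (u @ replicate k Vac @ c # v) = f (u @ c # replicate k Vac @ v)"
  using assms
proof (induction k arbitrary: u)
  case (Suc k)
  have "u @ c # Vac # replicate k Vac @ v \<in> configs L n" using Suc.prems by simp
  from swap_Vac[OF this] have "f (u @ Vac # c # replicate k Vac @ v) = f (u @ c # Vac # replicate k Vac @ v)" .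
  moreover have "(u @ [Vac]) @ c # replicate k Vac @ v \<in> configs L n"
    using Suc.prems by (auto simp: configs_def)
  from Suc.IH[OF this] have "f (u @ Vac # replicate k Vac @ c # v) = f (u @ Vac # c # replicate k Vac @ v)"
    by simp
  ultimately show ?case by simp
qed simp

text \<open>The vacancies of the tail are gathered first; then the leading letter, unless itself a
  vacancy, is carried over that block. The prefix \<open>u\<close> varies because invariance
  concerns whole configurations.\<close>

lemma move_Vac_front:
  assumes "u @ x \<in> configs L n"
  shows "f (u @ x) = f (u @ replicate (count_list x Vac) Vac @ filter (\<lambda>s. s \<noteq> Vac) x)"
  using assms
proof (induction x arbitrary: u)
  case (Cons c x)
  have IH: "f ((u @ [c]) @ x)
      = f ((u @ [c]) @ replicate (count_list x Vac) Vac @ filter (\<lambda>s. s \<noteq> Vac) x)"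
    using Cons by (intro Cons.IH) simp
  have m: "mset (replicate (count_list x Vac) Vac @ filter (\<lambda>s. s \<noteq> Vac) x) = mset x"
    by (simp add: multiset_eq_iff count_list_0_iff flip: count_mset)
  show ?case
  proof (cases "c = Vac")
    case False
    have "mset (u @ c # replicate (count_list x Vac) Vac @ filter (\<lambda>s. s \<noteq> Vac) x) = mset (u @ c # x)"
      using m by simp
    then have "u @ c # replicate (count_list x Vac) Vac @ filter (\<lambda>s. s \<noteq> Vac) x \<in> configs L n"
      using Cons.prems unfolding configs_def mem_Collect_eq
      by (metis count_mset size_mset)
    from swap_Vac_replicate[OF this] False IH show ?thesis by simp
  qed (use IH in simp)
qed simp

text \<open>Equal lengths and equal cores force equally many vacancies, so both words have the same
  normal form with all vacancies in front.\<close>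

lemma eq_if_filter_eq:
  assumes "x \<in> configs L n" "y \<in> configs L n"
    and "filter (\<lambda>s. s \<noteq> Vac) x = filter (\<lambda>s. s \<noteq> Vac) y"
  shows "f x = f y"
proof -
  have "count_list x Vac + length (filter (\<lambda>s. s \<noteq> Vac) x) = length x" for x :: "letter list"
    by (induction x) auto
  from this[of x] this[of y] assms have "count_list x Vac = count_list y Vac"
    by (simp add: configs_def)
  then show ?thesis
    using move_Vac_front[of "[]" x] move_Vac_front[of "[]" y] assms by simp
qed

text \<open>
  The first letter of the core is carried around the ring: it moves to the first site, from there
  over the bond between the last and the first site, with a vacancy parked on the last site.
\<close>

lemma rotate1_core:
  assumes "replicate (L - n - 1) Vac @ c \<in> configs L n"
  shows "f (replicate (L - n - 1) Vac @ rotate1 c) = f (replicate (L - n - 1) Vac @ c)"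
proof (cases c)
  case (Cons b c')
  \<comment> \<open>By \<open>n + 2 \<le> L\<close> there is a vacancy to park on the last
    site.\<close>
  obtain k where k: "L - n - 1 = Suc k" using L by (cases "L - n - 1") auto
  let ?\<eta> = "b # replicate k Vac @ c' @ [Vac]"
  have "replicate (Suc k) Vac @ b # c' \<in> configs L n" using assms by (simp only: k Cons)
  then have \<eta>: "?\<eta> \<in> configs L n" by (auto simp: configs_def)
  have "f ?\<eta> = f (replicate (L - n - 1) Vac @ c)"
    using \<eta> assms by (intro eq_if_filter_eq) (simp_all add: k Cons)
  moreover have "length ?\<eta> = L" using \<eta> by (simp add: configs_def)
  then have "Suc k + length c' < L" "next_site ?\<eta> (Suc k + length c') = 0"
    by (auto simp: next_site_def)
  moreover have "?\<eta> ! (Suc k + length c') = Vac" by (simp add: nth_append)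
  moreover have "swap_bond ?\<eta> (Suc k + length c') = Vac # replicate k Vac @ c' @ [b]"
    using calculation by (simp add: swap_bond_def nth_append list_update_append)
  ultimately show ?thesis
    using swap_inv[OF \<eta>, of "Suc k + length c'"] unfolding k Cons by simp
qed simp

text \<open>Up to vacancies, \<eta> is \<open>a\<close> letters \<open>Ord\<close>, the tracer and
  \<open>b\<close> letters \<open>Ord\<close>. Rotating this core \<open>a\<close> times puts the
  tracer first, whatever \<open>a\<close> and \<open>b\<close> were.\<close>

lemma const_on_configs:
  assumes "\<eta> \<in> configs L n"
  shows "f \<eta> = f (replicate (L - n - 1) Vac @ Tracer # replicate n Ord)"
proof -
  let ?V = "replicate (L - n - 1) Vac"
  obtain v u where e: "\<eta> = v @ Tracer # u" "Tracer \<notin> set v" "Tracer \<notin> set u"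
    using assms tracer_split[of \<eta>] by (auto simp: configs_def)
  have filt: "filter (\<lambda>s. s \<noteq> Vac) x = replicate (count_list x Ord) Ord" if "Tracer \<notin> set x" for x
    using that
  proof (induction x)
    case (Cons c x)
    then show ?case by (cases c) auto
  qed simp
  define a b where "a = count_list v Ord" and "b = count_list u Ord"
  have ab: "a + b = n" using assms e by (simp add: configs_def a_def b_def)
  have cr: "count_list (replicate k s) t = (if s = t then k else 0)" for k and s t :: letter
    by (induction k) auto
  let ?c = "replicate a Ord @ Tracer # replicate b Ord"
  have conf: "?V @ rotate j ?c \<in> configs L n" for j
  proof -
    show ?thesis using L ab by (simp add: configs_def cr count_list_rotate)
  qed
  have "f (?V @ rotate j ?c) = f (?V @ ?c)" for j
  proof (induction j)
    case (Suc j)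
    then show ?case using rotate1_core[OF conf[of j]] by simp
  qed simp
  from this[of a] have "f (?V @ Tracer # replicate b Ord @ replicate a Ord) = f (?V @ ?c)"
    using rotate_append[of "replicate a Ord" "Tracer # replicate b Ord"] by simp
  moreover have "f \<eta> = f (?V @ ?c)"
    using assms conf[of 0] by (intro eq_if_filter_eq) (simp_all add: e filt a_def b_def)
  ultimately show ?thesis using ab by (simp add: replicate_add[symmetric] add.commute)
qed

end

section \<open>Existence, uniqueness and form of the steady state\<close>

lemma bond_rate_nonneg: "0 \<le> p \<Longrightarrow> 0 \<le> q \<Longrightarrow> 0 \<le> bond_rate p q s t"
  by (cases s; cases t) auto

lemma jump_rate_nonneg: "0 \<le> p \<Longrightarrow> 0 \<le> q \<Longrightarrow> 0 \<le> jump_rate p q \<eta> \<eta>'"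
  unfolding jump_rate_def by (intro sum_nonneg) (simp add: bond_rate_nonneg)

lemma jump_rate_swap_bond_pos:
  assumes "0 \<le> p" "0 \<le> q" "i < length \<eta>" "0 < bond_rate p q (\<eta> ! i) (\<eta> ! next_site \<eta> i)"
  shows "0 < jump_rate p q \<eta> (swap_bond \<eta> i)"
  unfolding jump_rate_def
  by (rule sum_pos2[of _ i]) (use assms in \<open>auto simp: bond_rate_nonneg\<close>)

lemma stationary_pmf_eq:
  assumes st: "stationary L n p q \<pi>" and L: "n + 2 \<le> L" and p: "0 < p" and q: "0 \<le> q"
    and \<eta>: "\<eta> \<in> configs L n"
  shows "pmf \<pi> \<eta> = conf_wt p q n \<eta> / Z L n p q"
proof -
  let ?h = "\<lambda>\<eta>. pmf \<pi> \<eta> / conf_wt p q n \<eta>"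
  have edge: "?h x = ?h y" if "x \<in> configs L n" "y \<in> configs L n" "0 < jump_rate p q x y" for x y
    using st p q L that
    by (intro balance_ratio_eq[where C = "configs L n" and r = "jump_rate p q"])
      (auto simp: finite_configs conf_wt_pos jump_rate_nonneg conf_wt_balance stationary_def)
  have inv: "?h (swap_bond x i) = ?h x"
    if x: "x \<in> configs L n" "i < L" and v: "x ! i = Vac \<or> x ! next_site x i = Vac" for x i
  proof -
    have len: "length x = L" using x by (simp add: configs_def)
    have y: "swap_bond x i \<in> configs L n" using x by (rule swap_bond_in_configs)
    \<comment> \<open>Since \<open>q\<close> may be 0, a bond between tracer and vacancy may allow
      jumps in one direction only; \<open>0 < p\<close> guarantees that one, and an equality of
      ratios serves both directions.\<close>
    consider "0 < bond_rate p q (x ! i) (x ! next_site x i)"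
      | "0 < bond_rate p q (x ! next_site x i) (x ! i)"
      | "x ! i = x ! next_site x i"
      using v p by (cases "x ! i"; cases "x ! next_site x i") auto
    then show ?thesis
    proof cases
      case 1
      then show ?thesis
        using edge[OF x(1) y] jump_rate_swap_bond_pos[of p q i x] p q x len by simp
    next
      case 2
      then show ?thesis
        using edge[OF y x(1)] jump_rate_swap_bond_pos[of p q i "swap_bond x i"] p q x len
        by (simp add: nth_swap_bond swap_bond_swap_bond)
    next
      case 3
      then have "swap_bond x i = x" by (metis list_update_id swap_bond_def)
      then show ?thesis by simp
    qed
  qed
  define K where "K = ?h (replicate (L - n - 1) Vac @ Tracer # replicate n Ord)"
  have "?h x = K" if "x \<in> configs L n" for x
    unfolding K_def by (rule const_on_configs[where f = ?h, OF L inv that])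
  then have eq: "pmf \<pi> x = K * conf_wt p q n x" if "x \<in> configs L n" for x
    using that conf_wt_pos[of p q x L n] p q by (metis less_imp_le less_irrefl nonzero_divide_eq_eq)
  \<comment> \<open>Total mass 1 determines the constant ratio \<open>K\<close>.\<close>
  have "(\<Sum>x\<in>configs L n. pmf \<pi> x) = 1"
    using st by (intro sum_pmf_eq_1 finite_configs) (auto simp: stationary_def)
  moreover have "(\<Sum>x\<in>configs L n. pmf \<pi> x) = K * Z L n p q"
    using eq sum_conf_wt[of n L p q] L by (simp add: sum_distrib_left[symmetric])
  ultimately have "K = 1 / Z L n p q" by (metis eq_divide_eq zero_neq_one mult_zero_right)
  then show ?thesis using eq[OF \<eta>] by simp
qed

lemma stationary_exists:
  assumes L: "n + 2 \<le> L" and p: "0 \<le> p" and q: "0 \<le> q"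
  shows "\<exists>\<pi>. stationary L n p q \<pi>"
proof -
  let ?g = "\<lambda>\<eta>. if \<eta> \<in> configs L n then conf_wt p q n \<eta> / Z L n p q else 0"
  have Z: "0 < Z L n p q" using assms by (intro Z_pos) auto
  have nn: "0 \<le> ?g \<eta>" for \<eta>
    using Z conf_wt_pos[OF p q, of \<eta> L n] by (auto intro!: divide_nonneg_pos)
  have "(\<integral>\<^sup>+ \<eta>. ennreal (?g \<eta>) \<partial>count_space UNIV) = (\<Sum>\<eta>\<in>configs L n. ennreal (?g \<eta>))"
    by (rule nn_integral_count_space') (auto simp: finite_configs)
  also have "\<dots> = ennreal (\<Sum>\<eta>\<in>configs L n. ?g \<eta>)"
    by (rule sum_ennreal) (rule nn)
  also have "(\<Sum>\<eta>\<in>configs L n. ?g \<eta>) = 1"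
    using sum_conf_wt[of n L p q] L Z by (simp add: sum_divide_distrib[symmetric])
  finally have int: "(\<integral>\<^sup>+ \<eta>. ennreal (?g \<eta>) \<partial>count_space UNIV) = 1" by simp
  define \<pi> where "\<pi> = embed_pmf ?g"
  have pmf: "pmf \<pi> \<eta> = ?g \<eta>" for \<eta>
    unfolding \<pi>_def by (rule pmf_embed_pmf[OF nn int])
  have "set_pmf \<pi> \<subseteq> configs L n" by (auto simp: set_pmf_iff pmf split: if_splits)
  moreover have "(\<Sum>\<eta>'\<in>configs L n. pmf \<pi> \<eta>' * jump_rate p q \<eta>' \<eta>) =
      pmf \<pi> \<eta> * (\<Sum>\<eta>'\<in>configs L n. jump_rate p q \<eta> \<eta>')" if "\<eta> \<in> configs L n" for \<eta>
    using conf_wt_balance[OF that, of p q] L that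
    by (simp add: pmf sum_divide_distrib[symmetric])
  ultimately show ?thesis by (auto simp: stationary_def)
qed

lemma steady_state_stationary:
  assumes "n + 2 \<le> L" "0 < p" "0 \<le> q"
  shows "stationary L n p q (steady_state L n p q)"
proof -
  obtain \<pi> where \<pi>: "stationary L n p q \<pi>" using stationary_exists[of n L p q] assms by auto
  have "\<pi>' = \<pi>" if "stationary L n p q \<pi>'" for \<pi>'
  proof (rule pmf_eqI)
    fix \<eta>
    show "pmf \<pi>' \<eta> = pmf \<pi> \<eta>"
    proof (cases "\<eta> \<in> configs L n")
      case True
      then show ?thesis using stationary_pmf_eq that \<pi> assms by metis
    next
      case False
      then have "\<eta> \<notin> set_pmf \<pi>'" "\<eta> \<notin> set_pmf \<pi>" using that \<pi> by (auto simp: stationary_def)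
      then show ?thesis by (simp add: set_pmf_iff)
    qed
  qed
  then show ?thesis using \<pi> assms by (simp add: steady_state_def) (rule theI)
qed

section \<open>Steady-state means and the currents\<close>

lemma steady_mean_eq:
  assumes "n + 1 \<le> M" "0 < p" "0 \<le> q"
  shows "steady_mean (Suc M) n p q f =
    (\<Sum>k\<le>M. \<Sum>x\<in>words M n. wt p q n 0 x * f (drop k x @ Tracer # take k x)) / Z (Suc M) n p q"
proof -
  have st: "stationary (Suc M) n p q (steady_state (Suc M) n p q)"
    using assms by (intro steady_state_stationary) auto
  then have "steady_mean (Suc M) n p q f
    = (\<Sum>\<eta>\<in>configs (Suc M) n. f \<eta> * pmf (steady_state (Suc M) n p q) \<eta>)"
    unfolding steady_mean_def
    by (intro integral_measure_pmf_real finite_configs) (auto simp: stationary_def)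
  also have "\<dots> = (\<Sum>\<eta>\<in>configs (Suc M) n. conf_wt p q n \<eta> * f \<eta>) / Z (Suc M) n p q"
    using stationary_pmf_eq[OF st] assms by (simp add: sum_divide_distrib mult.commute)
  finally show ?thesis by (simp add: sum_configs conf_wt_unrotate)
qed

text \<open>Deleting the vacancy at \<open>j\<close> and reinserting it are inverse bijections that
  keep the number of letters \<open>Ord\<close>. This is how the bracket of the ring with one site
  fewer enters the currents.\<close>

lemma sum_words_Vac_at:
  assumes "j \<le> N"
  shows "(\<Sum>x\<in>words (Suc N) n. of_bool (x ! j = Vac) * g x) =
    (\<Sum>y\<in>words N n. g (take j y @ Vac # drop j y) :: real)"
proof -
  have "(\<Sum>x\<in>words (Suc N) n. of_bool (x ! j = Vac) * g x)
    = (\<Sum>x\<in>{x \<in> words (Suc N) n. x ! j = Vac}. g x)"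
    by (rule sum.mono_neutral_cong_right) (auto simp: finite_words)
  also have "\<dots> = (\<Sum>y\<in>words N n. g (take j y @ Vac # drop j y))"
  proof (rule sum.reindex_bij_witness[where
      i = "\<lambda>y. take j y @ Vac # drop j y" and j = "\<lambda>x. take j x @ drop (Suc j) x"])
    fix x assume "x \<in> {x \<in> words (Suc N) n. x ! j = Vac}"
    then have x: "x \<in> words (Suc N) n" "x ! j = Vac" and len: "j < length x"
      using assms by (auto simp: words_def)
    have id: "x = take j x @ Vac # drop (Suc j) x" using id_take_nth_drop[OF len] x by simp
    show e: "take j (take j x @ drop (Suc j) x) @ Vac # drop j (take j x @ drop (Suc j) x) = x"
      using id len by simp
    have "count_list (take j x @ Vac # drop (Suc j) x) Ord = n"
      using x unfolding id[symmetric] by (simp add: words_def)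
    then show "take j x @ drop (Suc j) x \<in> words N n"
      using x assms by (auto simp: words_def dest: in_set_takeD in_set_dropD)
    show "g (take j (take j x @ drop (Suc j) x) @ Vac # drop j (take j x @ drop (Suc j) x)) = g x"
      unfolding e ..
  next
    fix y assume y: "y \<in> words N n"
    then have len: "j \<le> length y" using assms by (simp add: words_def)
    then show "take j (take j y @ Vac # drop j y) @ drop (Suc j) (take j y @ Vac # drop j y) = y"
      by simp
    have "count_list (take j y @ drop j y) Ord = n" using y by (simp add: words_def)
    then show "take j y @ Vac # drop j y \<in> {x \<in> words (Suc N) n. x ! j = Vac}"
      using y len by (auto simp: words_def nth_append dest: in_set_takeD in_set_dropD
          simp del: append_take_drop_id)
  qed
  finally show ?thesis .
qed

text \<open>A vacancy does not affect the counts seen by other vacancies, so inserting it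
  contributes just its own factor.\<close>

lemma wt_insert_Vac:
  "wt p q n 0 (take j y @ Vac # drop j y) =
    (1 + p * real (count_list (take j y) Ord) + q * (real n - real (count_list (take j y) Ord)))
    * wt p q n 0 y"
  using wt_append[of p q n 0 "take j y" "drop j y"] by (simp add: wt_append)

text \<open>Deleting the vacancy turns both orders of the pair at \<open>k\<close> into a word with
  \<open>Ord\<close> at \<open>k\<close>. The vacancy standing after that \<open>Ord\<close> has one
  more \<open>Ord\<close> to its left, so the two factors differ by \<open>p - q\<close>.\<close>

lemma sum_words_Ord_Vac_diff:
  "(\<Sum>k<N. \<Sum>x\<in>words (Suc N) n. wt p q n 0 x *
      (of_bool (x ! k = Ord) * of_bool (x ! Suc k = Vac) - of_bool (x ! k = Vac) * of_bool (x ! Suc k = Ord)))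
    = (p - q) * real n * (\<Sum>y\<in>words N n. wt p q n 0 y)"
proof -
  have eq: "(\<Sum>x\<in>words (Suc N) n. wt p q n 0 x *
      (of_bool (x ! k = Ord) * of_bool (x ! Suc k = Vac) - of_bool (x ! k = Vac) * of_bool (x ! Suc k = Ord)))
    = (\<Sum>y\<in>words N n. (p - q) * wt p q n 0 y * of_bool (y ! k = Ord))" if k: "k < N" for k
  proof -
    have "(\<Sum>x\<in>words (Suc N) n. wt p q n 0 x *
      (of_bool (x ! k = Ord) * of_bool (x ! Suc k = Vac) - of_bool (x ! k = Vac) * of_bool (x ! Suc k = Ord)))
      = (\<Sum>x\<in>words (Suc N) n. of_bool (x ! Suc k = Vac) * (wt p q n 0 x * of_bool (x ! k = Ord)))
      - (\<Sum>x\<in>words (Suc N) n. of_bool (x ! k = Vac) * (wt p q n 0 x * of_bool (x ! Suc k = Ord)))"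
      unfolding sum_subtractf[symmetric] by (intro sum.cong refl) (simp add: algebra_simps)
    also have "\<dots> = (\<Sum>y\<in>words N n. (p - q) * wt p q n 0 y * of_bool (y ! k = Ord))"
      using k unfolding sum_words_Vac_at[OF Suc_leI[OF k]] sum_words_Vac_at[OF less_imp_le[OF k]]
        sum_subtractf[symmetric] wt_insert_Vac
      by (intro sum.cong refl)
        (auto simp: words_def nth_append take_Suc_conv_app_nth algebra_simps)
    finally show ?thesis .
  qed
  have cnt: "(\<Sum>k<N. of_bool (y ! k = Ord)) = real n" if "y \<in> words N n" for y
  proof -
    have "(\<Sum>k<N. of_bool (y ! k = Ord)) = real (card {k. k < length y \<and> y ! k = Ord})"
      using that by (simp add: words_def Int_def)
    then show ?thesis using that by (simp add: card_count_list words_def)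
  qed
  have "(\<Sum>k<N. \<Sum>x\<in>words (Suc N) n. wt p q n 0 x *
      (of_bool (x ! k = Ord) * of_bool (x ! Suc k = Vac) - of_bool (x ! k = Vac) * of_bool (x ! Suc k = Ord)))
    = (\<Sum>k<N. \<Sum>y\<in>words N n. (p - q) * wt p q n 0 y * of_bool (y ! k = Ord))"
    by (intro sum.cong refl eq) simp
  also have "\<dots> = (\<Sum>y\<in>words N n. (p - q) * wt p q n 0 y * (\<Sum>k<N. of_bool (y ! k = Ord)))"
    by (subst sum.swap) (simp only: sum_distrib_left)
  also have "\<dots> = (\<Sum>y\<in>words N n. ((p - q) * real n) * wt p q n 0 y)"
    by (intro sum.cong refl) (simp only: cnt ac_simps)
  finally show ?thesis by (simp add: sum_distrib_left)
qed

lemma one_minus_tau_sigma: "1 - tau i \<eta> - sigma i \<eta> = of_bool (\<eta> ! (i - 1) = Vac)"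
  by (cases "\<eta> ! (i - 1)") (auto simp: tau_def sigma_def)

lemma nth_unrotate:
  assumes "x \<in> words M n" "k \<le> M"
  shows "(drop k x @ Tracer # take k x) ! 0 = (if k = M then Tracer else x ! k)"
    and "(drop k x @ Tracer # take k x) ! M = (if k = 0 then Tracer else x ! (k - 1))"
  using assms by (auto simp: words_def nth_append nth_Cons')

lemma currents_words:
  assumes "n + 1 \<le> M" "0 < p" "0 \<le> q"
  shows "tracer_current (Suc M) n p q = (p - q) * (bracket p q M (n + 1) / Z (Suc M) n p q)"
    and "ordinary_current (Suc M) n p q = (p - q) * (real n * bracket p q M (n + 1) / Z (Suc M) n p q)"
proof -
  obtain N where M: "M = Suc N" and nN: "n \<le> N" using assms by (cases M) auto
  let ?B = "\<Sum>y\<in>words N n. wt p q n 0 y"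
  let ?rot = "\<lambda>k x. drop k x @ Tracer # take k x"
  have B: "bracket p q M (n + 1) = ?B" using bracket_eq_sum_words[OF nN] M by simp
  have noT: "x ! k \<noteq> Tracer" if "x \<in> words M n" "k < M" for x k
    using that nth_mem[of k x] by (force simp: words_def)
  \<comment> \<open>Only \<open>k = 0\<close> puts the tracer on the last site; the first site then
    holds the first letter of the word, with all \<open>n\<close> letters \<open>Ord\<close> to the
    right of its vacancy.\<close>
  have "(\<Sum>k\<le>M. \<Sum>x\<in>words M n. wt p q n 0 x * (of_bool (?rot k x ! M = Tracer) * of_bool (?rot k x ! 0 = Vac)))
    = (\<Sum>k\<le>M. if k = 0 then \<Sum>x\<in>words M n. of_bool (x ! 0 = Vac) * wt p q n 0 x else 0)"
    by (intro sum.cong refl) (auto simp: nth_unrotate noT M intro!: sum.cong sum.neutral)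
  also have "\<dots> = (1 + q * real n) * ?B"
    unfolding M using sum_words_Vac_at[of 0 N "wt p q n 0" n]
    by (simp add: sum_distrib_left)
  finally have fwd: "(\<Sum>k\<le>M. \<Sum>x\<in>words M n. wt p q n 0 x *
      (of_bool (?rot k x ! M = Tracer) * of_bool (?rot k x ! 0 = Vac))) = (1 + q * real n) * ?B" .
  \<comment> \<open>Only \<open>k = M\<close> puts the tracer on the first site; the last site then
    holds the last letter, at index \<open>N\<close>.\<close>
  have "(\<Sum>k\<le>M. \<Sum>x\<in>words M n. wt p q n 0 x * (of_bool (?rot k x ! M = Vac) * of_bool (?rot k x ! 0 = Tracer)))
    = (\<Sum>k\<le>M. if k = M then \<Sum>x\<in>words M n. of_bool (x ! N = Vac) * wt p q n 0 x else 0)"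
    by (intro sum.cong refl) (auto simp: nth_unrotate noT M intro!: sum.cong sum.neutral)
  also have "\<dots> = (\<Sum>y\<in>words N n. wt p q n 0 (take N y @ Vac # drop N y))"
    unfolding M using sum_words_Vac_at[of N N "wt p q n 0" n] by simp
  also have "\<dots> = (1 + p * real n) * ?B"
    unfolding sum_distrib_left by (intro sum.cong refl) (simp only: wt_insert_Vac, simp add: words_def)
  finally have bwd: "(\<Sum>k\<le>M. \<Sum>x\<in>words M n. wt p q n 0 x *
      (of_bool (?rot k x ! M = Vac) * of_bool (?rot k x ! 0 = Tracer))) = (1 + p * real n) * ?B" .
  show "tracer_current (Suc M) n p q = (p - q) * (bracket p q M (n + 1) / Z (Suc M) n p q)"
    unfolding tracer_current_def steady_mean_eq[OF assms] one_minus_tau_sigma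
    unfolding sigma_def diff_Suc_1 diff_self_eq_0 fwd bwd B
    by (simp add: algebra_simps add_divide_distrib diff_divide_distrib)
  let ?g = "\<lambda>k. \<Sum>x\<in>words M n. wt p q n 0 x *
    (of_bool (?rot k x ! M = Ord) * of_bool (?rot k x ! 0 = Vac)
      - of_bool (?rot k x ! M = Vac) * of_bool (?rot k x ! 0 = Ord))"
  \<comment> \<open>For \<open>0 < k < M\<close> the sites \<open>M\<close> and \<open>0\<close>
    hold the neighbouring letters \<open>k - 1\<close> and \<open>k\<close> of the word; for the two
    extreme values one of these sites holds the tracer and the term vanishes.\<close>
  have "(\<Sum>k\<le>M. ?g k) = ?g 0 + (\<Sum>k<N. ?g (Suc k)) + ?g M"
    unfolding M lessThan_Suc_atMost[symmetric]
    by (simp only: sum.lessThan_Suc_shift[of _ "Suc N"] sum.lessThan_Suc[of _ N] add.assoc)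
  moreover have "?g 0 = 0" "?g M = 0"
    by (intro sum.neutral ballI; simp only: nth_unrotate le0 order_refl; simp)+
  moreover have "(\<Sum>k<N. ?g (Suc k)) = (p - q) * real n * ?B"
    unfolding sum_words_Ord_Vac_diff[symmetric] M
    by (intro sum.cong refl) (auto simp: nth_unrotate)
  ultimately have ord: "(\<Sum>k\<le>M. ?g k) = (p - q) * real n * ?B" by simp
  show "ordinary_current (Suc M) n p q = (p - q) * (real n * bracket p q M (n + 1) / Z (Suc M) n p q)"
    unfolding ordinary_current_def steady_mean_eq[OF assms] one_minus_tau_sigma
    unfolding tau_def diff_Suc_1 diff_self_eq_0 diff_divide_distrib[symmetric] sum_subtractf[symmetric]
      right_diff_distrib[symmetric] ord B
    by simp
qed

text \<open>Counting letters leaves no vacancy, while every term of either current contains the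
  indicator of one.\<close>

lemma currents_full:
  assumes "L = n + 1"
  shows "tracer_current L n p q = 0" "ordinary_current L n p q = 0"
proof -
  have conf: "configs L n \<noteq> {}"
  proof -
    have "Tracer # replicate n Ord \<in> configs L n"
      using assms by (auto simp: configs_def count_list_0_iff simp flip: count_mset)
    then show ?thesis by auto
  qed
  have noVac: "\<eta> ! i \<noteq> Vac" if "\<eta> \<in> configs L n" "i < L" for \<eta> i
  proof -
    have "count_list x Vac + count_list x Ord + count_list x Tracer = length x" for x
    proof (induction x)
      case (Cons c x)
      then show ?case by (cases c) auto
    qed simp
    from this[of \<eta>] have "Vac \<notin> set \<eta>"
      using that assms by (simp add: configs_def count_list_0_iff)
    moreover have "length \<eta> = L" using that by (simp add: configs_def)
    ultimately show ?thesis using that by (metis nth_mem)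
  qed
  have mean: "steady_mean L n p q f = 0" if "\<And>\<eta>. \<eta> \<in> configs L n \<Longrightarrow> f \<eta> = 0" for f
    using that assms conf finite_configs[of L n]
    by (simp add: steady_mean_def steady_state_def integral_pmf_of_set)
  have "0 < L" "L - 1 < L" using assms by auto
  then show "tracer_current L n p q = 0" "ordinary_current L n p q = 0"
    unfolding tracer_current_def ordinary_current_def one_minus_tau_sigma
    by (simp_all add: mean noVac)
qed

theorem theorem2p8:
  fixes L n :: nat and p q :: real
  assumes "1 \<le> L" and "n \<le> L - 1"
    and "0 \<le> q" and "q \<le> p" and "p \<le> 1" and "0 < p"
  shows "tracer_current L n p q = (p - q) * (bracket p q (L - 1) (n + 1) / Z L n p q) \<and>
    ordinary_current L n p q = (p - q) * (real n * bracket p q (L - 1) (n + 1) / Z L n p q)"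
proof (cases "L = n + 1")
  case True
  \<comment> \<open>Here the bracket in the numerators has upper entry \<open>n\<close> below
    \<open>n + 1\<close>, hence is 0 by convention.\<close>
  then show ?thesis by (simp add: currents_full bracket_def)
next
  case False
  then have "L = Suc (L - 1)" "n + 1 \<le> L - 1" using assms by auto
  then show ?thesis using currents_words[of n "L - 1" p q] assms by simp
qed

end
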